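(* Let $a_1>a_2>\cdots>a_N>0$. For $i=1,\dots,N$, consider a system of $N-1$ functional equations for functions $f_i^k(n_i)$, $1\le k\le N$: $$\begin{cases}f_i^1(n_i)f_i^1(n_i+\frac12)-f_i^k(n_i)f_i^k(n_i+\frac12)=a_1-a_k,& k\le i,\\ f_i^1(n_i)f_i^1(n_i+\frac12)+f_i^k(n_i)f_i^k(n_i+\frac12)=a_1-a_k,& k>i\end{cases}$$ (the equation for $k=1$ being trivial). For any solution of these $N$ systems, the function $\boldsymbol x=(x_1,\dots,x_N)$ defined by $$x_k(\boldsymbol n)=\frac{\prod_{j=1}^Nf_j^k(n_j)}{\prod_{i=1}^{k-1}\sqrt{a_i-a_k}\,\prod_{i=k+1}^N\sqrt{a_k-a_i}},\qquad k=1,\dots,N,$$ constitutes a discrete confocal coordinate system. The corresponding values $u_i(n_i+\frac14)$ are determined by the equations $$f_i^k(n_i)f_i^k(n_i+\tfrac12)=\begin{cases}u_i(n_i+\frac14)+a_k,&k\le i,\\-\big(u_i(n_i+\frac14)+a_k\big),&k>i.\end{cases}$$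
   Context: $\boldsymbol e_i$ is the unit vector of the $i$-th coordinate direction; $\boldsymbol n=(n_1,\dots,n_N)$ with $n_i\in\frac12\mathbb Z$. Discrete coordinate system: a net $\boldsymbol x:(\tfrac12\mathbb Z)^N\supset\mathcal U\to\mathbb R^N$ such that at any $\boldsymbol n\in\mathcal U$ the $N$ discrete tangent vectors, arbitrarily chosen for each $j=1,\dots,N$ among $\boldsymbol x(\boldsymbol n+\boldsymbol e_j)-\boldsymbol x(\boldsymbol n)$ and $\boldsymbol x(\boldsymbol n)-\boldsymbol x(\boldsymbol n-\boldsymbol e_j)$, are linearly independent. Orthogonal net: for each edge $[\boldsymbol n,\boldsymbol n+\boldsymbol e_i]$, all $2^{N-1}$ points $\boldsymbol x(\boldsymbol n+\frac12\boldsymbol\sigma)$ with $\boldsymbol\sigma=(\sigma_1,\dots,\sigma_N)\in\{\pm1\}^N$, $\sigma_i=1$, lie in a hyperplane orthogonal to the line through $\boldsymbol x(\boldsymbol n)$ and $\boldsymbol x(\boldsymbol n+\boldsymbol e_i)$. Discrete confocal coordinate system: a discrete coordinate system which (i) factorizes, $x_k(\boldsymbol n)=g_1^k(n_1)\cdots g_N^k(n_N)$ for $k=1,\dots,N$, with $g_i^k(n_i)\ne0$ and $g_i^k(n_i)-g_i^k(n_i-1)\neq0$; and (ii) is an orthogonal net. To every discrete confocal coordinate system there belong sequences $u_i:\frac12\mathbb Z+\frac14\to\mathbb R$ and numbers $a_k$ with $\sum_{k=1}^N\frac{x_k(\boldsymbol n)x_k(\boldsymbol n+\frac12\boldsymbol\sigma)}{a_k+u_i(n_i+\frac14\sigma_i)}=1$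 for $i=1,\dots,N$ and $\boldsymbol\sigma\in\{\pm1\}^N$; the values $u_i$ in the claim are these.
   Formalization: "Any solution" is restricted to solutions with f_i^k(n_i) ≠ 0, f_i^k(n_i) − f_i^k(n_i−1) ≠ 0, and values u_i, u_j of different directions distinct at adjacent quarter-points; constant solutions, for example, give a constant x. *)

theory Defs
  imports "HOL-Analysis.Analysis"
begin

text \<open>
  The coordinate directions \<open>1, \<dots>, N\<close> are the elements of a type \<open>'n\<close> of classes
  \<open>finite\<close> and \<open>linorder\<close>, listed in increasing order. Half- and quarter-integers are
  kept as real numbers.
\<close>

definition half_ints :: "real set"
  where "half_ints = {t. 2 * t \<in> \<int>}"

definition half_lattice :: "(real ^ 'n) set"
  where "half_lattice = {n. \<forall>i. n $ i \<in> half_ints}"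

definition sign_vectors :: "(real ^ 'n) set"
  where "sign_vectors = {\<sigma>. \<forall>i. \<sigma> $ i = 1 \<or> \<sigma> $ i = -1}"

definition first_index :: "'n::{finite,linorder}"
  where "first_index = Min UNIV"

definition coord_range :: "(real ^ 'n) set \<Rightarrow> 'n \<Rightarrow> real set"
  where "coord_range U i = (\<lambda>n. n $ i) ` U"

text \<open>
  A net with domain \<open>U\<close> is a total function of which only the values on \<open>U\<close> are used;
  every condition below is imposed where all the net points it mentions lie in \<open>U\<close>.
\<close>

text \<open>The tangent vectors are independent as a family, so coincidences are excluded by \<open>inj\<close>.\<close>

definition tangent_vector :: "(real ^ 'n \<Rightarrow> real ^ 'n) \<Rightarrow> real ^ 'n \<Rightarrow> real ^ 'n \<Rightarrow> 'n \<Rightarrow> real ^ 'n"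
  where "tangent_vector x n \<sigma> j =
    (if \<sigma> $ j = 1 then x (n + axis j 1) - x n else x n - x (n - axis j 1))"

definition discrete_coordinate_system :: "(real ^ 'n) set \<Rightarrow> (real ^ 'n \<Rightarrow> real ^ 'n) \<Rightarrow> bool"
  where "discrete_coordinate_system U x \<longleftrightarrow>
    U \<subseteq> half_lattice \<and>
    (\<forall>n\<in>U. \<forall>\<sigma>\<in>sign_vectors. (\<forall>j. n + axis j (\<sigma> $ j) \<in> U) \<longrightarrow>
       inj (tangent_vector x n \<sigma>) \<and> independent (range (tangent_vector x n \<sigma>)))"

text \<open>The end points of an edge are required to be distinct, so that they span a line.\<close>

definition orthogonal_net :: "(real ^ 'n) set \<Rightarrow> (real ^ 'n \<Rightarrow> real ^ 'n) \<Rightarrow> bool"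
  where "orthogonal_net U x \<longleftrightarrow>
    (\<forall>n i. n \<in> U \<and> n + axis i 1 \<in> U \<longrightarrow>
       x (n + axis i 1) \<noteq> x n \<and>
       (\<exists>c. \<forall>\<sigma>\<in>sign_vectors. \<sigma> $ i = 1 \<and> n + (1/2) *\<^sub>R \<sigma> \<in> U \<longrightarrow>
          x (n + (1/2) *\<^sub>R \<sigma>) \<in> {y. (x (n + axis i 1) - x n) \<bullet> y = c}))"

text \<open>
  In the families \<open>g i k\<close> and \<open>f i k\<close> the first argument is the lower index (the direction)
  and the second one the upper index (the component of the net).
\<close>

definition nonvanishing_factors ::
    "(real ^ 'n) set \<Rightarrow> ('n \<Rightarrow> 'n \<Rightarrow> real \<Rightarrow> real) \<Rightarrow> bool"
  where "nonvanishing_factors U g \<longleftrightarrow>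
    (\<forall>i k. \<forall>t\<in>coord_range U i.
       g i k t \<noteq> 0 \<and> (t - 1 \<in> coord_range U i \<longrightarrow> g i k t - g i k (t - 1) \<noteq> 0))"

definition factorizes :: "(real ^ 'n) set \<Rightarrow> (real ^ 'n \<Rightarrow> real ^ 'n) \<Rightarrow> bool"
  where "factorizes U x \<longleftrightarrow>
    (\<exists>g. nonvanishing_factors U g \<and> (\<forall>n\<in>U. \<forall>k. x n $ k = (\<Prod>i\<in>UNIV. g i k (n $ i))))"

definition discrete_confocal_coordinate_system ::
    "(real ^ 'n) set \<Rightarrow> (real ^ 'n \<Rightarrow> real ^ 'n) \<Rightarrow> bool"
  where "discrete_confocal_coordinate_system U x \<longleftrightarrow>
    discrete_coordinate_system U x \<and> factorizes U x \<and> orthogonal_net U x"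

text \<open>
  The sequences \<open>u\<close> (on the quarter-integers \<open>half_ints + 1/4\<close>) belonging to a net and to the
  numbers \<open>a\<close>. Nonzero denominators are demanded explicitly because of \<open>x / 0 = 0\<close>.
\<close>

definition corresponding_values ::
    "(real ^ 'n) set \<Rightarrow> (real ^ 'n \<Rightarrow> real ^ 'n) \<Rightarrow> ('n \<Rightarrow> real) \<Rightarrow> ('n \<Rightarrow> real \<Rightarrow> real) \<Rightarrow> bool"
  where "corresponding_values U x a u \<longleftrightarrow>
    (\<forall>n\<in>U. \<forall>\<sigma>\<in>sign_vectors. n + (1/2) *\<^sub>R \<sigma> \<in> U \<longrightarrow>
       (\<forall>i. (\<forall>k. a k + u i (n $ i + (1/4) * \<sigma> $ i) \<noteq> 0) \<and>
            (\<Sum>k\<in>UNIV. x n $ k * x (n + (1/2) *\<^sub>R \<sigma>) $ k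
                       / (a k + u i (n $ i + (1/4) * \<sigma> $ i))) = 1))"

definition functional_equations ::
    "('n::{finite,linorder} \<Rightarrow> real) \<Rightarrow> ('n \<Rightarrow> 'n \<Rightarrow> real \<Rightarrow> real) \<Rightarrow> bool"
  where "functional_equations a f \<longleftrightarrow>
    (\<forall>i. \<forall>t\<in>half_ints. \<forall>k.
       (k \<le> i \<longrightarrow> f i first_index t * f i first_index (t + 1/2) - f i k t * f i k (t + 1/2)
                  = a first_index - a k) \<and>
       (k > i \<longrightarrow> f i first_index t * f i first_index (t + 1/2) + f i k t * f i k (t + 1/2)
                  = a first_index - a k))"

definition confocal_net ::
    "('n::{finite,linorder} \<Rightarrow> real) \<Rightarrow> ('n \<Rightarrow> 'n \<Rightarrow> real \<Rightarrow> real) \<Rightarrow> real ^ ('n::{finite,linorder}) \<Rightarrow> real ^ ('n::{finite,linorder})"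
  where "confocal_net a f n =
    (\<chi> k. (\<Prod>j\<in>UNIV. f j k (n $ j))
          / ((\<Prod>i\<in>{..<k}. sqrt (a i - a k)) * (\<Prod>i\<in>{k<..}. sqrt (a k - a i))))"

text \<open>The equations for \<open>u\<close> in terms of \<open>f\<close>, in direction \<open>i\<close> and at the half-integer \<open>t\<close>.\<close>

definition u_equations_at ::
    "('n::{finite,linorder} \<Rightarrow> real) \<Rightarrow> ('n \<Rightarrow> 'n \<Rightarrow> real \<Rightarrow> real) \<Rightarrow> ('n \<Rightarrow> real \<Rightarrow> real)
      \<Rightarrow> 'n \<Rightarrow> real \<Rightarrow> bool"
  where "u_equations_at a f u i t \<longleftrightarrow>
    (\<forall>k. f i k t * f i k (t + 1/2) =
           (if k \<le> i then u i (t + 1/4) + a k else - (u i (t + 1/4) + a k)))"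

text \<open>
  The functional equations admit degenerate solutions (constants, for example), for which the net
  is not a discrete coordinate system. The following two conditions single out the solutions that
  are regular on \<open>U\<close>. The first is the nonvanishing of the factors. As
  \<open>f i first_index (n $ i) * f i first_index (n $ i + \<sigma> $ i / 2) - a first_index\<close> is the value
  of \<open>u i\<close> at \<open>n $ i + \<sigma> $ i / 4\<close>, the second says that the values of \<open>u\<close> in different
  directions do not coincide. It holds automatically when all
  products \<open>f i k t * f i k (t + 1/2)\<close> are positive: then \<open>u i\<close> takes its values strictly
  between \<open>- a i\<close> and the negative of the next parameter (above \<open>- a i\<close> for the last \<open>i\<close>).
\<close>

definition separated_directions ::
    "(real ^ ('n::{finite,linorder})) set \<Rightarrow> ('n \<Rightarrow> 'n \<Rightarrow> real \<Rightarrow> real) \<Rightarrow> bool"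
  where "separated_directions U f \<longleftrightarrow>
    (\<forall>n\<in>U. \<forall>\<sigma>\<in>sign_vectors. (\<forall>j. n + axis j (\<sigma> $ j) \<in> U) \<longrightarrow>
       (\<forall>i j. i \<noteq> j \<longrightarrow>
          f i first_index (n $ i) * f i first_index (n $ i + (1/2) * \<sigma> $ i) \<noteq>
          f j first_index (n $ j) * f j first_index (n $ j + (1/2) * \<sigma> $ j)))"

definition unit_box :: "real ^ 'n \<Rightarrow> (real ^ 'n) set"
  where "unit_box p = {n \<in> half_lattice. \<forall>j. p $ j \<le> n $ j \<and> n $ j \<le> p $ j + 1}"

end

theory Submission
  imports Defs "HOL-Computational_Algebra.Polynomial"
begin

text \<open>
  The functional equations say that in each direction \<open>i\<close> the quantity
  \<open>\<plusminus> f i k t * f i k (t + 1/2) - a k\<close>, with sign \<open>+\<close> exactly for \<open>k \<le> i\<close>, is the same for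
  all \<open>k\<close>; call it \<open>u i (t + 1/4)\<close>. If \<open>w j = u j (n $ j + \<sigma> $ j / 4)\<close>, multiplying these
  relations over all directions gives
  \<open>x\<^sub>k(n) x\<^sub>k(n + \<sigma>/2) = (\<Prod>j. a k + w j) / (\<Prod>l\<noteq>k. a k - a l)\<close>,
  because the minus signs are as many as the factors \<open>a i - a k\<close>, \<open>i < k\<close>, that occur with the
  wrong sign (\<open>confocal_net_times_shift\<close>). Everything then follows from one identity: for these
  weights,
  \<open>1 - (\<Sum>k. x\<^sub>k(n) x\<^sub>k(n + \<sigma>/2) / (a k + v)) = (\<Prod>j. v - w j) / (\<Prod>k. v + a k)\<close>,
  the partial fraction expansion of a quotient of two monic polynomials of degree \<open>N\<close>. So \<open>v\<close>
  solves the confocal quadric equation if and only if \<open>v\<close> is one of the \<open>w j\<close>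
  (\<open>confocal_quadric_iff\<close>).

  \<^item> The \<open>u i\<close> therefore correspond to the net. Conversely, let \<open>v i\<close> be any corresponding
    values, and put \<open>n\<close> at the centre of a unit box. The sign \<open>\<sigma> $ j\<close> then selects \<open>w j\<close> from
    two numbers, which differ by the nonvanishing conditions. For \<open>j \<noteq> i\<close> take a value
    different from \<open>v i\<close>; the only root left for \<open>v i\<close> is \<open>w i\<close>.
  \<^item> Moving \<open>n\<close> to \<open>n + e\<^sub>i\<close> while fixing the point \<open>n + \<sigma>/2\<close> changes \<open>w i\<close> only, so
    by the quadric equation the product of \<open>x(n + \<sigma>/2)\<close> with the edge is the change of
    \<open>w i\<close>. It does not depend on the other signs, which is orthogonality.
  \<^item> In dimension at least two, the \<open>j\<close>-th tangent vector has components proportional to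
    \<open>x\<^sub>k(n) / (a k + w j)\<close>, so that independence is that of a Cauchy matrix (\<open>independent_if_cauchy_like\<close>); the \<open>w j\<close> are
    distinct because the directions are separated.
\<close>

section \<open>Interpolation at the parameters\<close>

text \<open>
  Both sides are monic in \<open>z\<close>, of degree the number of the nodes \<open>a k\<close>, and agree at all nodes.
\<close>

lemma interpolation_of_monic:
  fixes a w :: "'n::finite \<Rightarrow> 'b::field" and z :: 'b
  assumes "inj a"
  shows "(\<Prod>j\<in>UNIV. z + w j) = (\<Prod>k\<in>UNIV. z - a k) +
    (\<Sum>k\<in>UNIV. (\<Prod>j\<in>UNIV. a k + w j) / (\<Prod>l\<in>UNIV - {k}. a k - a l) *
       (\<Prod>l\<in>UNIV - {k}. z - a l))"
proof -
  define N where "N = CARD('n)"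
  define p where "p = (\<Prod>j\<in>UNIV. [:w j, 1:])"
  define q where "q = (\<Prod>k\<in>UNIV. [:- a k, 1:])"
  define c where "c k = (\<Prod>j\<in>UNIV. a k + w j) / (\<Prod>l\<in>UNIV - {k}. a k - a l)" for k
  define r where "r = (\<Sum>k\<in>UNIV. smult (c k) (\<Prod>l\<in>UNIV - {k}. [:- a l, 1:]))"
  have deg_p: "degree p = N" and deg_q: "degree q = N"
    by (simp_all add: p_def q_def N_def degree_prod_eq_sum_degree)
  have "lead_coeff p = 1" "lead_coeff q = 1"
    by (simp_all add: p_def q_def lead_coeff_prod)
  then have coeff_pq: "coeff p N = 1" "coeff q N = 1"
    by (simp_all add: deg_p deg_q)
  have deg_r: "degree r < N"
    unfolding r_def N_def
    by (rule degree_sum_less, rule le_less_trans[OF degree_smult_le])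
       (simp_all add: degree_prod_eq_sum_degree)
  have "p = q + r"
  proof (rule poly_eqI_degree_lead_coeff[where A = "range a" and n = N])
    show "coeff p N = coeff (q + r) N"
      using deg_r by (simp add: coeff_pq coeff_eq_0)
    show "N \<le> card (range a)"
      by (simp add: N_def card_image assms)
    show "degree p \<le> N" "degree (q + r) \<le> N"
      using deg_r by (auto simp: deg_p deg_q intro!: degree_add_le)
    show "poly p x = poly (q + r) x" if "x \<in> range a" for x
    proof -
      from that obtain m where x: "x = a m" by blast
      have "poly q x = 0"
        by (auto simp: q_def poly_prod x)
      moreover have "poly r x = (\<Sum>k\<in>UNIV. if k = m then poly p x else 0)"
        unfolding r_def poly_sum
      proof (rule sum.cong[OF refl])
        fix k
        show "poly (smult (c k) (\<Prod>l\<in>UNIV - {k}. [:- a l, 1:])) x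
          = (if k = m then poly p x else 0)"
        proof (cases "k = m")
          case True
          have "(\<Prod>l\<in>UNIV - {m}. a m - a l) \<noteq> 0"
            using assms by (auto simp: inj_eq)
          then show ?thesis
            using True by (simp add: c_def p_def poly_prod x add.commute)
        next
          case False
          then have "(\<Prod>l\<in>UNIV - {k}. a m - a l) = 0"
            by auto
          then show ?thesis
            using False by (simp add: poly_prod x)
        qed
      qed
      ultimately show ?thesis by simp
    qed
  qed
  then have "poly p z = poly q z + poly r z" by simp
  then show ?thesis
    by (simp add: p_def q_def r_def c_def poly_prod poly_sum add.commute)
qed

text \<open>
  Divide the interpolation formula at \<open>- v\<close> by the product of the \<open>- v - a k\<close>: the left side
  of the quadric equation differs from \<open>1\<close> by \<open>\<Prod>j. w j - v\<close> up to a nonzero factor.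
\<close>

lemma confocal_quadric_iff:
  fixes a w :: "'n::finite \<Rightarrow> 'b::field"
  assumes "inj a" and nz: "\<And>k. a k + v \<noteq> 0"
  shows "(\<Sum>k\<in>UNIV. (\<Prod>j\<in>UNIV. a k + w j) / (\<Prod>l\<in>UNIV - {k}. a k - a l) / (a k + v)) = 1
    \<longleftrightarrow> (\<exists>j. w j = v)"
    (is "?S = 1 \<longleftrightarrow> _")
proof -
  let ?q = "\<Prod>k\<in>UNIV. - v - a k"
  have nz': "- v - a k \<noteq> 0" for k
  proof -
    have "- v - a k = - (a k + v)" by simp
    then show ?thesis
      using nz[of k] by (simp only: neg_equal_0_iff_equal not_False_eq_True)
  qed
  then have q: "?q \<noteq> 0" by simp
  have "(\<Prod>l\<in>UNIV - {k}. - v - a l) = - ?q / (a k + v)" for k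
  proof -
    have "?q = (- v - a k) * (\<Prod>l\<in>UNIV - {k}. - v - a l)"
      by (simp add: prod.remove)
    also have "\<dots> = - ((a k + v) * (\<Prod>l\<in>UNIV - {k}. - v - a l))"
      by (simp add: algebra_simps)
    finally have "(a k + v) * (\<Prod>l\<in>UNIV - {k}. - v - a l) = - ?q"
      by (simp only: minus_minus)
    then show ?thesis
      by (metis nonzero_mult_div_cancel_left nz)
  qed
  then have "(\<Prod>j\<in>UNIV. - v + w j) = ?q + (\<Sum>k\<in>UNIV.
      (\<Prod>j\<in>UNIV. a k + w j) / (\<Prod>l\<in>UNIV - {k}. a k - a l) * (- ?q / (a k + v)))"
    using interpolation_of_monic[OF assms(1), of "- v" w] by simp
  also have "\<dots> = ?q * (1 - ?S)"
    by (simp add: sum_distrib_left right_diff_distrib sum_negf mult.commute)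
  finally have "?S = 1 \<longleftrightarrow> (\<Prod>j\<in>UNIV. - v + w j) = 0"
    using q by auto
  also have "\<dots> \<longleftrightarrow> (\<exists>j. w j = v)"
    by simp
  finally show ?thesis .
qed

text \<open>
  If \<open>d j \<noteq> 0\<close> for all \<open>j\<close>, the assumption on \<open>e\<close> makes it a Cauchy matrix with rescaled
  rows. Multiplied by \<open>\<Prod>l. a k + w l\<close>, a relation between the rows says that the \<open>a k\<close> are
  roots of a polynomial whose degree is less than their number; it vanishes identically, and its
  value at \<open>- w j\<close> isolates the \<open>j\<close>-th coefficient. A zero \<open>d j\<close> forces \<open>w j = - a k\<close> for all \<open>k\<close>, which is possible only in
  dimension one.
\<close>

lemma independent_if_cauchy_like:
  fixes a w d c :: "'n::finite \<Rightarrow> 'b::field" and e :: "'n \<Rightarrow> 'n \<Rightarrow> 'b"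
  assumes "inj a" "inj w"
    and e: "\<And>j k. e j k * (a k + w j) = d j"
    and e_nz: "\<And>j k. e j k \<noteq> 0"
    and relation: "\<And>k. (\<Sum>j\<in>UNIV. c j * e j k) = 0"
  shows "c i = 0"
proof (cases "d i = 0")
  case True
  then have "a k = - w i" for k
    using e[of i k] e_nz[of i k] by (simp add: eq_neg_iff_add_eq_0)
  then have "k = i" for k
    using \<open>inj a\<close> by (metis injD)
  then have "UNIV = {i}" by auto
  then show ?thesis
    using relation[of i] e_nz[of i i] unfolding \<open>UNIV = {i}\<close> by simp
next
  case False
  define p where "p = (\<Sum>j\<in>UNIV. smult (c j * d j) (\<Prod>l\<in>UNIV - {j}. [:w l, 1:]))"
  have deg: "degree p < CARD('n)"
    unfolding p_def
    by (rule degree_sum_less, rule le_less_trans[OF degree_smult_le])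
       (simp_all add: degree_prod_eq_sum_degree)
  have "p = 0"
  proof (rule poly_eqI_degree[where A = "range a"])
    fix x assume "x \<in> range a"
    then obtain k where x: "x = a k" by blast
    have "poly p x = (\<Sum>j\<in>UNIV. c j * d j * (\<Prod>l\<in>UNIV - {j}. a k + w l))"
      by (simp add: p_def poly_sum poly_prod x add.commute)
    also have "\<dots> = (\<Sum>j\<in>UNIV. c j * e j k * (\<Prod>l\<in>UNIV. a k + w l))"
    proof (rule sum.cong[OF refl])
      fix j
      have "(\<Prod>l\<in>UNIV. a k + w l) = (a k + w j) * (\<Prod>l\<in>UNIV - {j}. a k + w l)"
        by (rule prod.remove) auto
      then show "c j * d j * (\<Prod>l\<in>UNIV - {j}. a k + w l) = c j * e j k * (\<Prod>l\<in>UNIV. a k + w l)"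
        by (simp add: mult.assoc flip: e[of j k])
    qed
    also have "\<dots> = (\<Sum>j\<in>UNIV. c j * e j k) * (\<Prod>l\<in>UNIV. a k + w l)"
      by (simp add: sum_distrib_right)
    finally show "poly p x = poly 0 x"
      by (simp add: relation)
  qed (use deg in \<open>simp_all add: card_image \<open>inj a\<close>\<close>)
  then have "0 = poly p (- w i)" by simp
  also have "\<dots> = (\<Sum>j\<in>UNIV. if j = i then c i * d i * (\<Prod>l\<in>UNIV - {i}. w l - w i) else 0)"
    unfolding p_def poly_sum
  proof (rule sum.cong[OF refl])
    fix j
    have "(\<Prod>l\<in>UNIV - {j}. w l - w i) = 0" if "j \<noteq> i"
      using that by auto
    then show "poly (smult (c j * d j) (\<Prod>l\<in>UNIV - {j}. [:w l, 1:])) (- w i)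
      = (if j = i then c i * d i * (\<Prod>l\<in>UNIV - {i}. w l - w i) else 0)"
      by (simp add: poly_prod)
  qed
  finally have "c i * d i * (\<Prod>l\<in>UNIV - {i}. w l - w i) = 0"
    by simp
  moreover have "(\<Prod>l\<in>UNIV - {i}. w l - w i) \<noteq> 0"
    using \<open>inj w\<close> by (auto simp: inj_eq)
  ultimately show ?thesis
    using False by simp
qed

lemma inj_independent_family:
  fixes T :: "'n::finite \<Rightarrow> 'v::real_vector"
  assumes "\<And>c i. (\<Sum>j\<in>UNIV. c j *\<^sub>R T j) = 0 \<Longrightarrow> c i = 0"
  shows "inj T" "independent (range T)"
proof -
  show inj: "inj T"
  proof (rule injI, rule ccontr)
    fix i j assume ij: "T i = T j" "i \<noteq> j"
    let ?c = "\<lambda>l. if l = i then 1 else if l = j then - 1 else (0::real)"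
    have "(\<Sum>l\<in>UNIV. ?c l *\<^sub>R T l) = (\<Sum>l\<in>{i, j}. ?c l *\<^sub>R T l)"
      by (rule sum.mono_neutral_right) auto
    also have "\<dots> = 0"
      using ij by simp
    finally show False
      using assms[of ?c i] by simp
  qed
  show "independent (range T)"
  proof (rule independent_if_scalars_zero)
    fix c x assume "(\<Sum>x\<in>range T. c x *\<^sub>R x) = 0" and x: "x \<in> range T"
    then have "(\<Sum>j\<in>UNIV. c (T j) *\<^sub>R T j) = 0"
      by (simp add: sum.reindex[OF inj])
    with x show "c x = 0"
      using assms[of "\<lambda>j. c (T j)"] by auto
  qed simp
qed

section \<open>Products of factors over half an edge\<close>

lemma half_ints_add_half: "t \<in> half_ints \<Longrightarrow> t + 1/2 \<in> half_ints"
  and half_ints_minus_half: "t \<in> half_ints \<Longrightarrow> t - 1/2 \<in> half_ints"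
  by (auto simp: half_ints_def distrib_left right_diff_distrib)

lemma half_lattice_nth: "n \<in> half_lattice \<Longrightarrow> n $ i \<in> half_ints"
  by (simp add: half_lattice_def)

lemma nonvanishing_factor_nth:
  assumes "nonvanishing_factors U f" "n \<in> U"
  shows "f i k (n $ i) \<noteq> 0"
  using assms by (auto simp: nonvanishing_factors_def coord_range_def)

lemma nonvanishing_factor_step:
  assumes "nonvanishing_factors U f" "n \<in> U" "m \<in> U" "m $ i = n $ i + 1"
  shows "f i k (n $ i + 1) \<noteq> f i k (n $ i)"
proof -
  have "n $ i + 1 \<in> coord_range U i" "n $ i \<in> coord_range U i"
    using assms(2-4) unfolding coord_range_def by (metis imageI)+
  then show ?thesis
    using assms(1) unfolding nonvanishing_factors_def
    by (metis add_diff_cancel_right' right_minus_eq)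
qed

locale confocal_factors =
  fixes a :: "'n::{finite,linorder} \<Rightarrow> real"
    and f :: "'n \<Rightarrow> 'n \<Rightarrow> real \<Rightarrow> real"
  assumes a_decreasing: "i < j \<Longrightarrow> a i > a j"
    and solution: "functional_equations a f"
begin

definition quadric_parameter :: "'n \<Rightarrow> real \<Rightarrow> real"
  where "quadric_parameter i s =
    f i first_index (s - 1/4) * f i first_index (s + 1/4) - a first_index"

definition factor_sign :: "'n \<Rightarrow> 'n \<Rightarrow> real"
  where "factor_sign j k = (if k \<le> j then 1 else -1)"

lemma inj_a: "inj a"
  by (rule linorder_injI) (metis a_decreasing less_irrefl)

lemma factor_sign_squared [simp]: "factor_sign j k * factor_sign j k = 1"
  and factor_sign_nonzero [simp]: "factor_sign j k \<noteq> 0"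
  by (auto simp: factor_sign_def)

lemma factor_product:
  assumes "t \<in> half_ints"
  shows "f i k t * f i k (t + 1/2) = factor_sign i k * (a k + quadric_parameter i (t + 1/4))"
proof -
  have "t + 1/4 - 1/4 = t" "t + 1/4 + 1/4 = t + 1/2" by simp_all
  then have "quadric_parameter i (t + 1/4)
      = f i first_index t * f i first_index (t + 1/2) - a first_index"
    by (simp only: quadric_parameter_def)
  moreover have "f i first_index t * f i first_index (t + 1/2)
      - factor_sign i k * (f i k t * f i k (t + 1/2)) = a first_index - a k"
    using solution assms by (cases "k \<le> i") (auto simp: functional_equations_def factor_sign_def)
  ultimately have "factor_sign i k * (f i k t * f i k (t + 1/2))
      = a k + quadric_parameter i (t + 1/4)"
    by linarith
  then show ?thesis
    by (metis factor_sign_squared mult.assoc mult_1)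
qed

lemma factor_product_signed:
  assumes "t \<in> half_ints" "\<epsilon> = 1 \<or> \<epsilon> = -1"
  shows "f i k t * f i k (t + \<epsilon> / 2)
    = factor_sign i k * (a k + quadric_parameter i (t + \<epsilon> / 4))"
  using assms(2)
proof
  assume "\<epsilon> = 1"
  then show ?thesis using factor_product[OF assms(1)] by simp
next
  assume \<epsilon>: "\<epsilon> = -1"
  have "t - 1/2 + 1/2 = t" "t - 1/2 + 1/4 = t - 1/4" by simp_all
  then show ?thesis
    using factor_product[OF half_ints_minus_half[OF assms(1)], of i k] \<epsilon>
    by (simp add: mult.commute)
qed

lemma u_equations_at_iff:
  assumes "t \<in> half_ints"
  shows "u_equations_at a f v i t \<longleftrightarrow> v i (t + 1/4) = quadric_parameter i (t + 1/4)"
proof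
  assume "u_equations_at a f v i t"
  then have "f i i t * f i i (t + 1/2) = v i (t + 1/4) + a i"
    by (simp add: u_equations_at_def)
  then show "v i (t + 1/4) = quadric_parameter i (t + 1/4)"
    using factor_product[OF assms, of i i] by (simp add: factor_sign_def)
next
  assume "v i (t + 1/4) = quadric_parameter i (t + 1/4)"
  then show "u_equations_at a f v i t"
    by (simp add: u_equations_at_def factor_product[OF assms] factor_sign_def)
qed

definition net_denominator :: "'n \<Rightarrow> real"
  where "net_denominator k =
    (\<Prod>i\<in>{..<k}. sqrt (a i - a k)) * (\<Prod>i\<in>{k<..}. sqrt (a k - a i))"

lemma confocal_net_nth: "confocal_net a f n $ k = (\<Prod>j\<in>UNIV. f j k (n $ j)) / net_denominator k"
  by (simp add: confocal_net_def net_denominator_def)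

text \<open>
  The denominator squared is a product of \<open>\<bar>a k - a l\<bar>\<close>. Removing the absolute values costs a
  sign for each \<open>l < k\<close>, and these are the directions whose factors carry a minus sign.
\<close>

lemma net_denominator_squared:
  "net_denominator k * net_denominator k
    = (\<Prod>j\<in>UNIV. factor_sign j k) * (\<Prod>l\<in>UNIV - {k}. a k - a l)"
proof -
  have split: "UNIV - {k} = {..<k} \<union> {k<..}" and split': "UNIV = {..<k} \<union> {k..}"
    by auto
  have signs: "(\<Prod>j\<in>UNIV. factor_sign j k) = (\<Prod>j\<in>{..<k}. - 1)"
  proof -
    have "(\<Prod>j\<in>UNIV. factor_sign j k)
        = (\<Prod>j\<in>{..<k}. factor_sign j k) * (\<Prod>j\<in>{k..}. factor_sign j k)"
      unfolding split' by (rule prod.union_disjoint) auto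
    also have "(\<Prod>j\<in>{k..}. factor_sign j k) = 1"
      by (rule prod.neutral) (simp add: factor_sign_def)
    also have "(\<Prod>j\<in>{..<k}. factor_sign j k) = (\<Prod>j\<in>{..<k}. - 1)"
      by (rule prod.cong) (auto simp: factor_sign_def)
    finally show ?thesis by simp
  qed
  have "net_denominator k * net_denominator k
    = (\<Prod>l\<in>{..<k}. sqrt (a l - a k) * sqrt (a l - a k))
      * (\<Prod>l\<in>{k<..}. sqrt (a k - a l) * sqrt (a k - a l))"
    unfolding net_denominator_def prod.distrib by (simp only: mult_ac)
  also have "(\<Prod>l\<in>{..<k}. sqrt (a l - a k) * sqrt (a l - a k)) = (\<Prod>l\<in>{..<k}. - 1 * (a k - a l))"
    by (rule prod.cong) (auto dest: a_decreasing)
  also have "(\<Prod>l\<in>{k<..}. sqrt (a k - a l) * sqrt (a k - a l)) = (\<Prod>l\<in>{k<..}. a k - a l)"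
    by (rule prod.cong) (auto dest: a_decreasing)
  also have "(\<Prod>l\<in>{..<k}. - 1 * (a k - a l)) * (\<Prod>l\<in>{k<..}. a k - a l)
    = (\<Prod>j\<in>UNIV. factor_sign j k) * ((\<Prod>l\<in>{..<k}. a k - a l) * (\<Prod>l\<in>{k<..}. a k - a l))"
    unfolding prod.distrib signs by (simp only: mult_ac)
  also have "(\<Prod>l\<in>{..<k}. a k - a l) * (\<Prod>l\<in>{k<..}. a k - a l) = (\<Prod>l\<in>UNIV - {k}. a k - a l)"
    unfolding split by (rule prod.union_disjoint[symmetric]) auto
  finally show ?thesis .
qed

lemma net_denominator_nonzero: "net_denominator k \<noteq> 0"
proof -
  have "net_denominator k * net_denominator k \<noteq> 0"
    unfolding net_denominator_squared using inj_a by (auto simp: inj_eq)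
  then show ?thesis by auto
qed

lemma confocal_net_times_shift:
  assumes n: "n \<in> half_lattice" and \<sigma>: "\<sigma> \<in> sign_vectors"
  shows "confocal_net a f n $ k * confocal_net a f (n + (1/2) *\<^sub>R \<sigma>) $ k
    = (\<Prod>j\<in>UNIV. a k + quadric_parameter j (n $ j + \<sigma> $ j / 4))
      / (\<Prod>l\<in>UNIV - {k}. a k - a l)"
proof -
  let ?s = "\<Prod>j\<in>UNIV. factor_sign j k"
  let ?P = "\<Prod>j\<in>UNIV. a k + quadric_parameter j (n $ j + \<sigma> $ j / 4)"
  have "confocal_net a f n $ k * confocal_net a f (n + (1/2) *\<^sub>R \<sigma>) $ k
    = (\<Prod>j\<in>UNIV. f j k (n $ j) * f j k (n $ j + \<sigma> $ j / 2))
      / (net_denominator k * net_denominator k)"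
    by (simp add: confocal_net_nth prod.distrib)
  also have "(\<Prod>j\<in>UNIV. f j k (n $ j) * f j k (n $ j + \<sigma> $ j / 2)) = ?s * ?P"
    unfolding prod.distrib[symmetric]
    by (rule prod.cong[OF refl], rule factor_product_signed)
       (use n \<sigma> in \<open>auto simp: half_lattice_nth sign_vectors_def\<close>)
  finally show ?thesis
    by (simp add: net_denominator_squared)
qed

lemma quadric_denominator_nonzero:
  assumes "U \<subseteq> half_lattice" "nonvanishing_factors U f"
    and "n \<in> U" "\<sigma> \<in> sign_vectors" "n + (1/2) *\<^sub>R \<sigma> \<in> U"
  shows "a k + quadric_parameter j (n $ j + \<sigma> $ j / 4) \<noteq> 0"
proof -
  have "f j k (n $ j) * f j k (n $ j + \<sigma> $ j / 2) \<noteq> 0"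
    using nonvanishing_factor_nth[OF assms(2,3), of j k]
      nonvanishing_factor_nth[OF assms(2,5), of j k] by simp
  moreover have "n $ j \<in> half_ints" "\<sigma> $ j = 1 \<or> \<sigma> $ j = -1"
    using assms(1,3,4) by (auto simp: half_lattice_nth sign_vectors_def)
  ultimately show ?thesis
    by (auto simp: factor_product_signed)
qed

text \<open>
  The difference of two consecutive values of \<open>u\<close> is that of two products with the common
  factor at the half-integer between them.
\<close>

lemma quadric_parameter_difference:
  assumes "t \<in> half_ints" "\<epsilon> = 1 \<or> \<epsilon> = -1"
  shows "f i k (t + \<epsilon> / 2) * (f i k (t + \<epsilon>) - f i k t)
    = factor_sign i k * (quadric_parameter i (t + \<epsilon> * 3/4) - quadric_parameter i (t + \<epsilon> / 4))"
proof -
  have "t + \<epsilon> / 2 \<in> half_ints"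
    using assms half_ints_add_half[of t] half_ints_minus_half[of t] by auto
  moreover have "t + \<epsilon> / 2 + \<epsilon> / 2 = t + \<epsilon>" "t + \<epsilon> / 2 + \<epsilon> / 4 = t + \<epsilon> * 3/4"
    by simp_all
  ultimately have "f i k (t + \<epsilon> / 2) * f i k (t + \<epsilon>)
      = factor_sign i k * (a k + quadric_parameter i (t + \<epsilon> * 3/4))"
    using factor_product_signed[OF _ assms(2), of "t + \<epsilon> / 2" i k] by (simp only:)
  then show ?thesis
    using factor_product_signed[OF assms, of i k] by (simp add: algebra_simps)
qed

section \<open>The corresponding values\<close>

lemma corresponding_values_quadric_parameter:
  assumes "U \<subseteq> half_lattice" "nonvanishing_factors U f"
  shows "corresponding_values U (confocal_net a f) a quadric_parameter"
  unfolding corresponding_values_def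
proof (intro ballI impI allI conjI)
  fix n \<sigma> i
  assume n: "n \<in> U" and \<sigma>: "\<sigma> \<in> sign_vectors" and n\<sigma>: "n + (1/2) *\<^sub>R \<sigma> \<in> U"
  show nz: "a k + quadric_parameter i (n $ i + 1/4 * \<sigma> $ i) \<noteq> 0" for k
    using quadric_denominator_nonzero[OF assms n \<sigma> n\<sigma>] by simp
  show "(\<Sum>k\<in>UNIV. confocal_net a f n $ k * confocal_net a f (n + (1/2) *\<^sub>R \<sigma>) $ k
      / (a k + quadric_parameter i (n $ i + 1/4 * \<sigma> $ i))) = 1"
    using confocal_quadric_iff[OF inj_a nz,
        of "\<lambda>j. quadric_parameter j (n $ j + \<sigma> $ j / 4)"] n assms(1) \<sigma>
    by (subst confocal_net_times_shift) auto
qed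

lemma corresponding_values_unique:
  assumes "U \<subseteq> half_lattice" "nonvanishing_factors U f"
    and v: "corresponding_values U (confocal_net a f) a v"
    and p: "p \<in> half_lattice" "unit_box p \<subseteq> U" and \<epsilon>: "\<epsilon> = 1 \<or> \<epsilon> = -1"
  shows "v i (p $ i + 1/2 + \<epsilon> / 4) = quadric_parameter i (p $ i + 1/2 + \<epsilon> / 4)"
proof -
  define n where "n = (\<chi> j. p $ j + 1/2)"
  have box: "m \<in> U" if "\<And>j. m $ j = p $ j \<or> m $ j = p $ j + 1/2 \<or> m $ j = p $ j + 1" for m
  proof -
    have "m $ j \<in> half_ints" for j
    proof -
      have "p $ j \<in> half_ints" using p(1) by (rule half_lattice_nth)
      moreover from this have "p $ j + 1/2 \<in> half_ints" by (rule half_ints_add_half)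
      moreover from this have "p $ j + 1 \<in> half_ints"
        using half_ints_add_half[of "p $ j + 1/2"] by (simp add: add.commute)
      ultimately show ?thesis using that[of j] by metis
    qed
    moreover have "p $ j \<le> m $ j \<and> m $ j \<le> p $ j + 1" for j
      using that[of j] by auto
    ultimately have "m \<in> unit_box p"
      by (simp add: unit_box_def half_lattice_def)
    with p(2) show ?thesis by blast
  qed
  have nU: "n \<in> U" by (rule box) (simp add: n_def)
  have distinct: "quadric_parameter j (p $ j + 3/4) \<noteq> quadric_parameter j (p $ j + 1/4)" for j
  proof -
    define m where "m = (\<chi> j. p $ j + 1)"
    have "p \<in> U" "m \<in> U" by (rule box; simp add: m_def)+
    then have "f j j (p $ j + 1) \<noteq> f j j (p $ j)"
      by (rule nonvanishing_factor_step[OF assms(2)]) (simp add: m_def)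
    moreover have "f j j (p $ j + 1/2) \<noteq> 0"
      using nonvanishing_factor_nth[OF assms(2) nU, of j j] by (simp add: n_def)
    moreover have "p $ j \<in> half_ints" using p(1) by (rule half_lattice_nth)
    ultimately show ?thesis
      using quadric_parameter_difference[of "p $ j" 1 j j] by auto
  qed
  define \<nu> where "\<nu> = v i (p $ i + 1/2 + \<epsilon> / 4)"
  \<comment> \<open>In every other direction the side of the centre is taken where the value of \<open>u\<close> is not \<open>\<nu>\<close>.\<close>
  define \<sigma> where "\<sigma> = (\<chi> j. if j = i then \<epsilon>
    else if quadric_parameter j (p $ j + 3/4) = \<nu> then -1 else 1)"
  have \<sigma>: "\<sigma> \<in> sign_vectors"
    using \<epsilon> by (auto simp: sign_vectors_def \<sigma>_def)
  have n\<sigma>: "n + (1/2) *\<^sub>R \<sigma> \<in> U"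
    by (rule box) (use \<epsilon> in \<open>auto simp: n_def \<sigma>_def\<close>)
  let ?w = "\<lambda>j. quadric_parameter j (n $ j + \<sigma> $ j / 4)"
  have \<nu>: "\<nu> = v i (n $ i + 1/4 * \<sigma> $ i)"
    by (simp add: \<nu>_def n_def \<sigma>_def)
  have nz: "\<And>k. a k + \<nu> \<noteq> 0"
    using v[unfolded corresponding_values_def, rule_format, OF nU \<sigma> n\<sigma>, of i, folded \<nu>]
    by blast
  have "(\<Sum>k\<in>UNIV. confocal_net a f n $ k * confocal_net a f (n + (1/2) *\<^sub>R \<sigma>) $ k
      / (a k + \<nu>)) = 1"
    using v[unfolded corresponding_values_def, rule_format, OF nU \<sigma> n\<sigma>, of i, folded \<nu>]
    by blast
  moreover have "n \<in> half_lattice"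
    using nU assms(1) by blast
  ultimately have "(\<Sum>k\<in>UNIV. (\<Prod>j\<in>UNIV. a k + ?w j) / (\<Prod>l\<in>UNIV - {k}. a k - a l)
      / (a k + \<nu>)) = 1"
    by (simp only: confocal_net_times_shift \<sigma>)
  then have "\<exists>j. ?w j = \<nu>"
    by (rule iffD1[OF confocal_quadric_iff[OF inj_a nz]])
  then obtain j where j: "?w j = \<nu>" ..
  have "j = i"
  proof (rule ccontr)
    assume "j \<noteq> i"
    then have \<sigma>j: "\<sigma> $ j = (if quadric_parameter j (p $ j + 3/4) = \<nu> then -1 else 1)"
      unfolding \<sigma>_def by simp
    have nj: "n $ j = p $ j + 1/2"
      unfolding n_def by simp
    show False
    proof (cases "quadric_parameter j (p $ j + 3/4) = \<nu>")
      case True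
      have "n $ j + \<sigma> $ j / 4 = p $ j + 1/4"
        unfolding \<sigma>j nj using True by simp
      then show False
        using j distinct[of j] True by simp
    next
      case False
      have "n $ j + \<sigma> $ j / 4 = p $ j + 3/4"
        unfolding \<sigma>j nj using False by simp
      then show False
        using j False by simp
    qed
  qed
  with j show ?thesis
    by (simp add: \<nu>_def n_def \<sigma>_def)
qed

section \<open>Coordinate systems, factorization and orthogonality\<close>

lemma factorizes_confocal_net:
  assumes "nonvanishing_factors U f"
  shows "factorizes U (confocal_net a f)"
proof -
  define g where "g i k t = (if i = first_index then 1 / net_denominator k else 1) * f i k t" for i k t
  have "nonvanishing_factors U g"
    using assms unfolding nonvanishing_factors_def g_def
    by (auto simp: net_denominator_nonzero simp flip: diff_divide_distrib)
  moreover have "confocal_net a f n $ k = (\<Prod>i\<in>UNIV. g i k (n $ i))" for n k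
    by (simp add: confocal_net_nth g_def prod.distrib)
  ultimately show ?thesis
    unfolding factorizes_def by blast
qed

lemma confocal_net_axis:
  assumes "f j k (n $ j) \<noteq> 0"
  shows "confocal_net a f (n + axis j \<epsilon>) $ k
    = confocal_net a f n $ k * (f j k (n $ j + \<epsilon>) / f j k (n $ j))"
proof -
  have "(\<Prod>i\<in>UNIV. f i k ((n + axis j \<epsilon>) $ i))
      = f j k (n $ j + \<epsilon>) * (\<Prod>i\<in>UNIV - {j}. f i k (n $ i))"
    by (subst prod.remove[of UNIV j]) (auto simp: axis_def intro!: prod.cong)
  moreover have "(\<Prod>i\<in>UNIV. f i k (n $ i)) = f j k (n $ j) * (\<Prod>i\<in>UNIV - {j}. f i k (n $ i))"
    by (rule prod.remove) auto
  ultimately show ?thesis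
    using assms by (simp add: confocal_net_nth)
qed

lemma confocal_net_nonzero:
  assumes "nonvanishing_factors U f" "n \<in> U"
  shows "confocal_net a f n $ k \<noteq> 0"
  by (simp add: confocal_net_nth net_denominator_nonzero nonvanishing_factor_nth[OF assms])

text \<open>
  The vectors \<open>x(n) x(n + \<sigma>/2)\<close> and \<open>x(n + e\<^sub>i) x(n + \<sigma>/2)\<close> of componentwise products have
  the same factors \<open>a k + w j\<close> for \<open>j \<noteq> i\<close>. In their difference \<open>a k + w i\<close> is replaced by
  the constant \<open>w' - w i\<close>, so summation over \<open>k\<close> leaves \<open>w' - w i\<close> times the left side of
  the quadric equation.
\<close>

lemma edge_inner_confocal_net:
  assumes "U \<subseteq> half_lattice" "nonvanishing_factors U f"
    and n: "n \<in> U" "n + axis i 1 \<in> U"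
    and \<sigma>: "\<sigma> \<in> sign_vectors" "\<sigma> $ i = 1" and n\<sigma>: "n + (1/2) *\<^sub>R \<sigma> \<in> U"
  shows "(confocal_net a f (n + axis i 1) - confocal_net a f n) \<bullet> confocal_net a f (n + (1/2) *\<^sub>R \<sigma>)
    = quadric_parameter i (n $ i + 3/4) - quadric_parameter i (n $ i + 1/4)"
    (is "?edge \<bullet> ?y = ?u' - ?u")
proof -
  \<comment> \<open>The signs that lead to the same point from the other end of the edge.\<close>
  define \<sigma>' where "\<sigma>' = \<sigma> - axis i 2"
  have \<sigma>': "\<sigma>' \<in> sign_vectors"
    using \<sigma> by (auto simp: sign_vectors_def \<sigma>'_def axis_def)
  have mid: "(n + axis i 1) + (1/2) *\<^sub>R \<sigma>' = n + (1/2) *\<^sub>R \<sigma>"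
    by (simp add: vec_eq_iff \<sigma>'_def axis_def field_simps)
  let ?w = "\<lambda>j. quadric_parameter j (n $ j + \<sigma> $ j / 4)"
  let ?R = "\<lambda>k. \<Prod>j\<in>UNIV - {i}. a k + ?w j"
  let ?D = "\<lambda>k. \<Prod>l\<in>UNIV - {k}. a k - a l"
  have wi: "?w i = ?u" by (simp add: \<sigma>)
  have nz: "a k + ?u \<noteq> 0" for k
    using quadric_denominator_nonzero[OF assms(1,2) n(1) \<sigma>(1) n\<sigma>, of k i] by (simp add: \<sigma>(2))
  have P: "(\<Prod>j\<in>UNIV. a k + ?w j) = (a k + ?u) * ?R k" for k
    by (subst prod.remove[of UNIV i]) (simp_all add: \<sigma>(2))
  have start: "confocal_net a f n $ k * ?y $ k = (a k + ?u) * ?R k / ?D k" for k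
    using confocal_net_times_shift[of n \<sigma> k] n(1) assms(1) \<sigma>(1) unfolding P by blast
  have finish: "confocal_net a f (n + axis i 1) $ k * ?y $ k = (a k + ?u') * ?R k / ?D k" for k
  proof -
    have "(\<Prod>j\<in>UNIV. a k + quadric_parameter j ((n + axis i 1) $ j + \<sigma>' $ j / 4))
        = (a k + ?u') * ?R k"
    proof (subst prod.remove[of UNIV i])
      have "(n + axis i 1) $ i + \<sigma>' $ i / 4 = n $ i + 3/4"
        by (simp add: \<sigma>'_def \<sigma>(2))
      moreover have "(\<Prod>j\<in>UNIV - {i}. a k + quadric_parameter j ((n + axis i 1) $ j + \<sigma>' $ j / 4))
          = ?R k"
        by (rule prod.cong) (auto simp: \<sigma>'_def axis_def)
      ultimately show "(a k + quadric_parameter i ((n + axis i 1) $ i + \<sigma>' $ i / 4)) *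
          (\<Prod>j\<in>UNIV - {i}. a k + quadric_parameter j ((n + axis i 1) $ j + \<sigma>' $ j / 4))
          = (a k + ?u') * ?R k"
        by (simp only:)
    qed auto
    then show ?thesis
      using confocal_net_times_shift[of "n + axis i 1" \<sigma>' k] n(2) assms(1) \<sigma>' mid by auto
  qed
  have "?edge \<bullet> ?y = (\<Sum>k\<in>UNIV. ?edge $ k * ?y $ k)"
    by (simp add: inner_vec_def)
  also have "\<dots> = (\<Sum>k\<in>UNIV. (?u' - ?u) * ((\<Prod>j\<in>UNIV. a k + ?w j) / ?D k / (a k + ?u)))"
  proof (rule sum.cong[OF refl])
    fix k
    have "?edge $ k * ?y $ k = (a k + ?u') * ?R k / ?D k - (a k + ?u) * ?R k / ?D k"
      unfolding start[symmetric] finish[symmetric] by (simp add: left_diff_distrib)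
    also have "\<dots> = ((a k + ?u') - (a k + ?u)) * (?R k / ?D k)"
      by (simp only: left_diff_distrib times_divide_eq_right diff_divide_distrib)
    also have "?R k / ?D k = (\<Prod>j\<in>UNIV. a k + ?w j) / ?D k / (a k + ?u)"
      unfolding P using nz[of k] by simp
    finally show "?edge $ k * ?y $ k = (?u' - ?u) * ((\<Prod>j\<in>UNIV. a k + ?w j) / ?D k / (a k + ?u))"
      by simp
  qed
  also have "\<dots> = ?u' - ?u"
  proof -
    have "(\<Sum>k\<in>UNIV. (\<Prod>j\<in>UNIV. a k + ?w j) / ?D k / (a k + ?u)) = 1"
      using confocal_quadric_iff[OF inj_a nz, of ?w] wi by blast
    then show ?thesis
      unfolding sum_distrib_left[symmetric] by simp
  qed
  finally show ?thesis .
qed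

lemma orthogonal_net_confocal_net:
  assumes "U \<subseteq> half_lattice" "nonvanishing_factors U f"
  shows "orthogonal_net U (confocal_net a f)"
  unfolding orthogonal_net_def
proof (intro allI impI, elim conjE, intro conjI)
  fix n i
  assume n: "n \<in> U" "n + axis i 1 \<in> U"
  have "f i i (n $ i + 1) \<noteq> f i i (n $ i)"
    using n by (rule nonvanishing_factor_step[OF assms(2)]) simp
  then have "confocal_net a f (n + axis i 1) $ i \<noteq> confocal_net a f n $ i"
    using nonvanishing_factor_nth[OF assms(2) n(1), of i i]
      confocal_net_nonzero[OF assms(2) n(1), of i]
    by (simp add: confocal_net_axis divide_eq_eq)
  then show "confocal_net a f (n + axis i 1) \<noteq> confocal_net a f n"
    by auto
  show "\<exists>c. \<forall>\<sigma>\<in>sign_vectors. \<sigma> $ i = 1 \<and> n + (1/2) *\<^sub>R \<sigma> \<in> U \<longrightarrow>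
      confocal_net a f (n + (1/2) *\<^sub>R \<sigma>)
        \<in> {y. (confocal_net a f (n + axis i 1) - confocal_net a f n) \<bullet> y = c}"
    using edge_inner_confocal_net[OF assms n] by blast
qed

lemma discrete_coordinate_system_confocal_net:
  assumes "U \<subseteq> half_lattice" "nonvanishing_factors U f" "separated_directions U f"
  shows "discrete_coordinate_system U (confocal_net a f)"
  unfolding discrete_coordinate_system_def
proof (intro conjI ballI impI)
  show "U \<subseteq> half_lattice" by fact
  fix n \<sigma>
  assume n: "n \<in> U" and \<sigma>: "\<sigma> \<in> sign_vectors" and n\<sigma>: "\<forall>j. n + axis j (\<sigma> $ j) \<in> U"
  let ?T = "tangent_vector (confocal_net a f) n \<sigma>"
  define w where "w j = quadric_parameter j (n $ j + \<sigma> $ j / 4)" for j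
  define d where "d j = quadric_parameter j (n $ j + \<sigma> $ j * 3/4) - w j" for j
  define e where "e j k = f j k (n $ j + \<sigma> $ j) / f j k (n $ j) - 1" for j k
  have t: "n $ j \<in> half_ints" and sj: "\<sigma> $ j = 1 \<or> \<sigma> $ j = -1" for j
    using n \<sigma> assms(1) by (auto simp: half_lattice_nth sign_vectors_def)
  have f_nz: "f j k (n $ j) \<noteq> 0" for j k
    by (rule nonvanishing_factor_nth[OF assms(2) n])
  have w_eq: "w j = f j first_index (n $ j) * f j first_index (n $ j + \<sigma> $ j / 2) - a first_index" for j
  proof -
    have "first_index \<le> j" by (simp add: first_index_def)
    then show ?thesis
      using factor_product_signed[OF t sj, of j first_index]
      by (simp add: w_def factor_sign_def)
  qed
  have "inj w"
  proof (rule injI, rule ccontr)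
    fix i j assume "w i = w j" "i \<noteq> j"
    moreover have "f i first_index (n $ i) * f i first_index (n $ i + 1/2 * \<sigma> $ i)
        \<noteq> f j first_index (n $ j) * f j first_index (n $ j + 1/2 * \<sigma> $ j)"
      using assms(3) n \<sigma> n\<sigma> \<open>i \<noteq> j\<close> unfolding separated_directions_def by blast
    ultimately show False
      by (simp add: w_eq)
  qed
  have e_nz: "e j k \<noteq> 0" for j k
  proof -
    have "f j k (n $ j + \<sigma> $ j) \<noteq> f j k (n $ j)"
      using sj[of j]
    proof
      assume "\<sigma> $ j = 1"
      then show ?thesis
        using nonvanishing_factor_step[OF assms(2) n n\<sigma>[rule_format], of j j k] by simp
    next
      assume "\<sigma> $ j = -1"
      then show ?thesis
        using nonvanishing_factor_step[OF assms(2) n\<sigma>[rule_format] n, of j j k] by simp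
    qed
    then show ?thesis
      using f_nz[of j k] by (simp add: e_def)
  qed
  have e_w: "e j k * (a k + w j) = d j" for j k
  proof -
    let ?h = "f j k (n $ j + \<sigma> $ j / 2)"
    have aw: "a k + w j = factor_sign j k * (f j k (n $ j) * ?h)"
      unfolding w_def factor_product_signed[OF t sj] by (simp flip: mult.assoc)
    have d_eq: "d j = factor_sign j k * (?h * (f j k (n $ j + \<sigma> $ j) - f j k (n $ j)))"
      unfolding d_def w_def quadric_parameter_difference[OF t sj] by (simp flip: mult.assoc)
    have e_f: "e j k * f j k (n $ j) = f j k (n $ j + \<sigma> $ j) - f j k (n $ j)"
      using f_nz[of j k] by (simp add: e_def left_diff_distrib)
    have "e j k * (a k + w j) = factor_sign j k * (?h * (e j k * f j k (n $ j)))"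
      unfolding aw by (simp only: mult_ac)
    also have "\<dots> = d j"
      unfolding e_f by (rule d_eq[symmetric])
    finally show ?thesis .
  qed
  have T_nth: "?T j $ k = \<sigma> $ j * e j k * confocal_net a f n $ k" for j k
    using sj[of j]
  proof
    assume "\<sigma> $ j = 1"
    then show ?thesis
      by (simp add: tangent_vector_def confocal_net_axis[OF f_nz] e_def algebra_simps)
  next
    assume s: "\<sigma> $ j = -1"
    have backward: "n - axis j 1 = n + axis j (\<sigma> $ j)"
      by (simp add: vec_eq_iff axis_def s)
    have "?T j $ k = confocal_net a f n $ k - confocal_net a f (n + axis j (\<sigma> $ j)) $ k"
      unfolding backward[symmetric] by (simp add: tangent_vector_def s)
    then show ?thesis
      by (simp add: confocal_net_axis[OF f_nz] e_def s algebra_simps)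
  qed
  have combination: "c i = 0" if "(\<Sum>j\<in>UNIV. c j *\<^sub>R ?T j) = 0" for c i
  proof -
    have "(\<Sum>j\<in>UNIV. (c j * \<sigma> $ j) * e j k) = 0" for k
    proof -
      have "0 = (\<Sum>j\<in>UNIV. c j *\<^sub>R ?T j) $ k" using that by simp
      also have "\<dots> = (\<Sum>j\<in>UNIV. (c j * \<sigma> $ j) * e j k) * confocal_net a f n $ k"
        by (simp add: T_nth sum_distrib_right mult.assoc)
      finally show ?thesis
        using confocal_net_nonzero[OF assms(2) n, of k] by simp
    qed
    then have "c i * \<sigma> $ i = 0"
      by (rule independent_if_cauchy_like[OF inj_a \<open>inj w\<close> e_w e_nz])
    then show ?thesis
      using sj[of i] by auto
  qed
  show "inj ?T" "independent (range ?T)"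
    using inj_independent_family[of ?T] combination by blast+
qed

end

section \<open>Discrete confocal coordinates from the functional equations\<close>

theorem theorem5p6:
  fixes a :: "'n::{finite,linorder} \<Rightarrow> real"
    and f :: "'n \<Rightarrow> 'n \<Rightarrow> real \<Rightarrow> real"
    and U :: "(real ^ ('n::{finite,linorder})) set"
  assumes a_decreasing: "\<And>i j. i < j \<Longrightarrow> a i > a j"
    and a_pos: "\<And>i. a i > 0"
    and solution: "functional_equations a f"
    and domain: "U \<subseteq> half_lattice"
    and nonvanishing: "nonvanishing_factors U f"
    and separated: "separated_directions U f"
  shows "discrete_confocal_coordinate_system U (confocal_net a f) \<and>
    (\<exists>u. (\<forall>i. \<forall>t\<in>half_ints. u_equations_at a f u i t) \<and>
         corresponding_values U (confocal_net a f) a u \<and>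
         (\<forall>v i. \<forall>t\<in>half_ints. u_equations_at a f v i t \<longrightarrow> v i (t + 1/4) = u i (t + 1/4))) \<and>
    (\<forall>v. corresponding_values U (confocal_net a f) a v \<longrightarrow>
       (\<forall>p\<in>half_lattice. unit_box p \<subseteq> U \<longrightarrow>
          (\<forall>i. u_equations_at a f v i (p $ i) \<and> u_equations_at a f v i (p $ i + 1/2))))"
proof -
  interpret confocal_factors a f
    by unfold_locales (fact a_decreasing, fact solution)
  show ?thesis
  proof (intro conjI)
    show "discrete_confocal_coordinate_system U (confocal_net a f)"
      unfolding discrete_confocal_coordinate_system_def
      using discrete_coordinate_system_confocal_net[OF domain nonvanishing separated]
        factorizes_confocal_net[OF nonvanishing]
        orthogonal_net_confocal_net[OF domain nonvanishing]
      by blast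
    show "\<exists>u. (\<forall>i. \<forall>t\<in>half_ints. u_equations_at a f u i t) \<and>
        corresponding_values U (confocal_net a f) a u \<and>
        (\<forall>v i. \<forall>t\<in>half_ints. u_equations_at a f v i t \<longrightarrow> v i (t + 1/4) = u i (t + 1/4))"
      using corresponding_values_quadric_parameter[OF domain nonvanishing]
      by (intro exI[of _ quadric_parameter]) (simp add: u_equations_at_iff)
    show "\<forall>v. corresponding_values U (confocal_net a f) a v \<longrightarrow>
        (\<forall>p\<in>half_lattice. unit_box p \<subseteq> U \<longrightarrow>
          (\<forall>i. u_equations_at a f v i (p $ i) \<and> u_equations_at a f v i (p $ i + 1/2)))"
    proof (intro allI impI ballI)
      fix v p i
      assume v: "corresponding_values U (confocal_net a f) a v"
        and p: "p \<in> half_lattice" "unit_box p \<subseteq> U"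
      note unique = corresponding_values_unique[OF domain nonvanishing v p]
      have t: "p $ i \<in> half_ints" using p(1) by (rule half_lattice_nth)
      have quarter: "p $ i + 1/2 + (- 1) / 4 = p $ i + 1/4" by simp
      show "u_equations_at a f v i (p $ i) \<and> u_equations_at a f v i (p $ i + 1/2)"
        using unique[of "- 1" i] unique[of 1 i]
        unfolding u_equations_at_iff[OF t] u_equations_at_iff[OF half_ints_add_half[OF t]] quarter
        by simp
    qed
  qed
qed

end
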